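(* Let $\mathcal{A}=(a_{i_1i_2\cdots i_m})$ be an order $m$ dimension $n$ nonnegative weakly irreducible tensor and let $x=(x_1,\ldots,x_n)$ be any vector with all entries positive. Then \[ \min_{\gamma\in C(G_{\mathcal{A}})}\Big(\prod_{i\in\gamma} \frac{(\mathcal{A}x^{m-1})_i}{x_i^{m-1}}\Big)^{\frac{1}{|\gamma|}}\leqslant \rho(\mathcal{A})\leqslant \max_{\gamma\in C(G_{\mathcal{A}})}\Big(\prod_{i\in\gamma} \frac{(\mathcal{A}x^{m-1})_i}{x_i^{m-1}}\Big)^{\frac{1}{|\gamma|}}. \]
   Context: $(\mathcal{A}x^{m-1})_i=\sum_{i_2,\ldots,i_m=1}^n a_{ii_2\cdots i_m}x_{i_2}\cdots x_{i_m}$; $\lambda\in\mathbb{C}$ is an eigenvalue of $\mathcal{A}$ if $\mathcal{A}x^{m-1}=\lambda(x_1^{m-1},\ldots,x_n^{m-1})^{\mathrm T}$ for some nonzero $x\in\mathbb{C}^n$; $\rho(\mathcal{A})$ is the maximum modulus of eigenvalues. The digraph $G_{\mathcal{A}}$ has vertices $\{1,\ldots,n\}$ and an arc $(i,j)$ whenever $a_{ii_2\cdots i_m}\neq0$ for some $i_2,\ldots,i_m$ with $j\in\{i_2,\ldots,i_m\}$ (loops allowed); $\mathcal{A}$ is weakly irreducible if $G_{\mathcal{A}}$ is strongly connected. $C(G_{\mathcal{A}})$ is the set of circuits, i.e. directed closed paths $i_1\to\cdots\to i_p\to i_1$ with $i_1,\ldots,i_p$ distinct (loops allowed); $|\gamma|=p$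 and $\prod_{i\in\gamma}$ is the product over $i_1,\ldots,i_p$. *)

theory Defs
  imports "HOL-Analysis.Analysis" "Graph_Theory.Digraph_Component"
begin

text \<open>
  A tensor of order \<open>m\<close> and dimension \<open>n = CARD('n)\<close> is given by its entries
  \<open>A [i\<^sub>1, \<dots>, i\<^sub>m]\<close>; only the values of \<open>A\<close> on lists of length \<open>m\<close> matter.
\<close>

type_synonym ('a, 'n) tensor = "'n list \<Rightarrow> 'a"

definition nonneg_tensor :: "nat \<Rightarrow> (real, 'n) tensor \<Rightarrow> bool" where
  "nonneg_tensor m A \<longleftrightarrow> (\<forall>is. length is = m \<longrightarrow> 0 \<le> A is)"

text \<open>The vector \<open>A x\<^bsup>m-1\<^esup>\<close>; the list \<open>js\<close> is the multi-index \<open>[i\<^sub>2, \<dots>, i\<^sub>m]\<close>.\<close>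

definition tensor_apply ::
  "nat \<Rightarrow> ('a::comm_semiring_1, 'n::finite) tensor \<Rightarrow> 'a ^ 'n \<Rightarrow> 'a ^ 'n" where
  "tensor_apply m A x =
     (\<chi> i. \<Sum>js | length js = m - 1. A (i # js) * (\<Prod>j\<leftarrow>js. x $ j))"

definition tensor_eigenvalue :: "nat \<Rightarrow> (complex, 'n::finite) tensor \<Rightarrow> complex \<Rightarrow> bool" where
  "tensor_eigenvalue m A l \<longleftrightarrow>
     (\<exists>x :: complex ^ 'n. x \<noteq> 0 \<and> tensor_apply m A x = (\<chi> i. l * x $ i ^ (m - 1)))"

text \<open>
  \<open>Max\<close> is meaningful only for finite sets, and finiteness of the set of eigenvalues is not
  evident from the definition, so the maximum modulus is expressed by \<open>GREATEST\<close>.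
\<close>

definition tensor_spectral_radius :: "nat \<Rightarrow> (complex, 'n::finite) tensor \<Rightarrow> real" where
  "tensor_spectral_radius m A = (GREATEST r. \<exists>l. tensor_eigenvalue m A l \<and> r = cmod l)"

definition tensor_digraph ::
  "nat \<Rightarrow> ('a::zero, 'n) tensor \<Rightarrow> ('n, 'n \<times> 'n) pre_digraph" where
  "tensor_digraph m A =
     \<lparr>verts = UNIV,
      arcs = {(i, j). \<exists>js. length js = m - 1 \<and> A (i # js) \<noteq> 0 \<and> j \<in> set js},
      tail = fst, head = snd\<rparr>"

definition weakly_irreducible :: "nat \<Rightarrow> ('a::zero, 'n) tensor \<Rightarrow> bool" where
  "weakly_irreducible m A \<longleftrightarrow> strongly_connected (tensor_digraph m A)"

text \<open>
  A circuit is the nonempty list of its consecutive arcs, so \<open>length\<close> is the number of its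
  vertices. The rotations of a circuit are distinct elements of \<open>circuits G\<close>, but
  \<open>circuit_mean\<close> below depends only on the circuit up to rotation.
\<close>

definition circuits :: "('v, 'e) pre_digraph \<Rightarrow> 'e list set" where
  "circuits G = {p. pre_digraph.cycle G p}"

definition circuit_verts :: "('v, 'e) pre_digraph \<Rightarrow> 'e list \<Rightarrow> 'v set" where
  "circuit_verts G p = tail G ` set p"

definition circuit_mean :: "('v, 'e) pre_digraph \<Rightarrow> ('v \<Rightarrow> real) \<Rightarrow> 'e list \<Rightarrow> real" where
  "circuit_mean G f p = root (length p) (\<Prod>i\<in>circuit_verts G p. f i)"

end

theory Submission
  imports Defs
begin

text \<open>
  A nonnegative weakly irreducible tensor has a positive eigenvector \<open>y\<close>, obtained by minimizing
  \<open>max\<^sub>i (A y\<^bsup>m-1\<^esup>)\<^sub>i / y\<^sub>i\<^bsup>m-1\<^esup>\<close> over positive \<open>y\<close>; its eigenvalue is the spectral radius \<open>\<rho>\<close>.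
  Put \<open>u\<^sub>i = x\<^sub>i / y\<^sub>i\<close> and let \<open>s i\<close> be an out-neighbour of \<open>i\<close> at which \<open>u\<close> is largest. Then
  \<open>(A x\<^bsup>m-1\<^esup>)\<^sub>i / x\<^sub>i\<^bsup>m-1\<^esup> \<le> \<rho> (u\<^bsub>s i\<^esub> / u\<^sub>i)\<^bsup>m-1\<^esup>\<close>, and along a circuit
  on which \<open>s\<close> acts as a rotation the factors \<open>u\<^bsub>s i\<^esub> / u\<^sub>i\<close> multiply to \<open>1\<close>. Choosing the
  smallest \<open>u\<close> instead gives the other bound.
\<close>

section \<open>Cycles traced by a selection of out-neighbours\<close>

text \<open>Turns the distinctness condition in \<open>cycle\<close>, which concerns the tail of
  \<open>awalk_verts\<close>, into distinctness of \<open>map (head G) p\<close>.\<close>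

lemma cas_imp_awalk_verts:
  "pre_digraph.cas G u p v \<Longrightarrow> pre_digraph.awalk_verts G u p = u # map (head G) p"
  by (induction p arbitrary: u)
    (simp_all add: pre_digraph.cas.simps pre_digraph.awalk_verts.simps)

text \<open>The heads along a cycle are distinct, hence so are its arcs, and a finite set admits
  only finitely many repetition-free lists. This makes \<open>Min\<close> and \<open>Max\<close>
  over circuits meaningful.\<close>

lemma finite_circuits:
  assumes "finite (arcs G)"
  shows "finite (circuits G)"
proof (rule finite_subset)
  show "circuits G \<subseteq> {p. set p \<subseteq> arcs G \<and> distinct p}"
    by (auto simp: circuits_def pre_digraph.cycle_def pre_digraph.awalk_def
        cas_imp_awalk_verts distinct_map)
  show "finite {p. set p \<subseteq> arcs G \<and> distinct p}"
    using assms by (rule finite_subset_distinct)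
qed

text \<open>The period is least among all points, not only for \<open>v\<close>: equal iterates of
  \<open>v\<close> at \<open>a < b\<close> give period \<open>b - a\<close> to the different point
  \<open>(s ^^ a) v\<close>.\<close>

lemma self_map_minimal_period:
  fixes s :: "'a::finite \<Rightarrow> 'a"
  obtains v p where "0 < p" "(s ^^ p) v = v" "inj_on (\<lambda>t. (s ^^ t) v) {..<p}"
proof -
  define P where "P p \<longleftrightarrow> 0 < p \<and> (\<exists>v. (s ^^ p) v = v)" for p :: nat
  have periodic: "P (b - a)" if "a < b" "(s ^^ a) w = (s ^^ b) w" for a b w
  proof -
    have "(s ^^ (b - a)) ((s ^^ a) w) = (s ^^ (b - a + a)) w"
      by (simp only: funpow_add comp_apply)
    then show ?thesis
      using that by (auto simp: P_def)
  qed
  \<comment> \<open>\<open>undefined\<close> is an arbitrary starting point; its orbit repeats by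
    the pigeonhole principle.\<close>
  have "\<not> inj (\<lambda>t. (s ^^ t) undefined)"
    using finite_imageD[of "\<lambda>t. (s ^^ t) undefined" UNIV] by (meson finite infinite_UNIV_nat)
  then obtain a b :: nat where "a \<noteq> b" "(s ^^ a) undefined = (s ^^ b) undefined"
    by (auto simp: inj_def)
  then have "\<exists>p. P p"
    by (metis periodic linorder_neqE_nat)
  then have "P (LEAST p. P p)"
    by (rule LeastI_ex)
  then obtain v where v: "0 < (LEAST p. P p)" "(s ^^ (LEAST p. P p)) v = v"
    unfolding P_def[of "LEAST p. P p"] by blast
  have "inj_on (\<lambda>t. (s ^^ t) v) {..<LEAST p. P p}"
  proof (rule linorder_inj_onI')
    fix a b assume ab: "a \<in> {..<LEAST p. P p}" "b \<in> {..<LEAST p. P p}" "a < b"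
    show "(s ^^ a) v \<noteq> (s ^^ b) v"
    proof
      assume "(s ^^ a) v = (s ^^ b) v"
      then have "(LEAST p. P p) \<le> b - a"
        using ab periodic by (intro Least_le) auto
      with ab show False
        by auto
    qed
  qed
  with v show thesis
    by (rule that)
qed

text \<open>The circuit is a periodic orbit of \<open>s\<close> of least period. The cardinality
  clause ensures that the product in \<open>circuit_mean\<close> has as many factors as the order of
  the root.\<close>

lemma circuit_of_selection:
  fixes s :: "'n::finite \<Rightarrow> 'n"
  assumes G: "verts G = UNIV" "tail G = fst" "head G = snd" and s: "\<And>i. (i, s i) \<in> arcs G"
  obtains c where "c \<in> circuits G" "card (circuit_verts G c) = length c" "c \<noteq> []"
    "bij_betw s (circuit_verts G c) (circuit_verts G c)"
proof -
  obtain v p where p: "0 < p" "(s ^^ p) v = v" and inj: "inj_on (\<lambda>t. (s ^^ t) v) {..<p}"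
    by (rule self_map_minimal_period)
  define w where "w t = (s ^^ t) v" for t
  define c where "c = map (\<lambda>t. (w t, w (Suc t))) [0..<p]"
  have w: "w 0 = v" "w p = v" "\<And>t. w (Suc t) = s (w t)"
    using p by (simp_all add: w_def)
  have inj: "inj_on w {..<p}"
    using inj by (simp add: w_def[abs_def])
  \<comment> \<open>The start \<open>a\<close> is arbitrary because \<open>cas\<close> consumes arcs
    from the front, which moves the start in the induction.\<close>
  have cas: "pre_digraph.cas G (w a) (map (\<lambda>t. (w t, w (Suc t))) [a..<a + d]) (w (a + d))" for a d
    by (induction d arbitrary: a)
      (simp_all add: pre_digraph.cas.simps upt_conv_Cons G del: upt_Suc, metis add_Suc)
  \<comment> \<open>Since \<open>w p = w 0\<close>, advancing the index only rotates the orbit. This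
    yields distinct heads by counting, and surjectivity of \<open>s\<close> on the circuit.\<close>
  have shift: "w ` Suc ` {..<p} = w ` {..<p}"
  proof -
    have "Suc ` {..<p} = insert p {1..<p}" "{..<p} = insert 0 {1..<p}"
      using p by (auto simp: image_Suc_lessThan)
    then show ?thesis
      by (simp only: image_insert w(1,2))
  qed
  have verts: "circuit_verts G c = w ` {..<p}"
    by (auto simp: circuit_verts_def c_def G image_image atLeast0LessThan)
  have heads: "map (head G) c = map (w \<circ> Suc) [0..<p]"
    by (simp add: c_def G)
  have "card ((w \<circ> Suc) ` {..<p}) = card {..<p}"
    using shift card_image[OF inj] by (simp add: image_comp)
  then have "inj_on (w \<circ> Suc) {..<p}"
    by (intro eq_card_imp_inj_on) auto
  then have "distinct (map (head G) c)"
    unfolding heads by (simp add: distinct_map atLeast0LessThan)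
  moreover have "pre_digraph.awalk G v c v"
    using cas[of 0 p] w s by (auto simp: pre_digraph.awalk_def G c_def)
  moreover have "c \<noteq> []"
    using p by (simp add: c_def)
  ultimately have "c \<in> circuits G"
    by (auto simp: circuits_def pre_digraph.cycle_def pre_digraph.awalk_def
        cas_imp_awalk_verts intro!: exI[of _ v])
  moreover have "s ` w ` {..<p} = w ` {..<p}"
    using shift by (simp add: image_image w)
  then have "bij_betw s (circuit_verts G c) (circuit_verts G c)"
    unfolding verts bij_betw_def by (simp add: eq_card_imp_inj_on)
  moreover have "card (circuit_verts G c) = length c"
    by (subst verts) (simp add: card_image inj c_def)
  ultimately show thesis
    using that \<open>c \<noteq> []\<close> by blast
qed

text \<open>A permutation of \<open>V\<close> leaves the product of \<open>h\<close> unchanged, so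
  the quotients cancel.\<close>

lemma prod_cocycle:
  fixes h :: "'n \<Rightarrow> real"
  assumes "bij_betw s V V" and "\<And>i. i \<in> V \<Longrightarrow> h i \<noteq> 0"
  shows "(\<Prod>i\<in>V. l * (h (s i) / h i)) = l ^ card V"
proof -
  have "(\<Prod>i\<in>V. h (s i)) = (\<Prod>i\<in>V. h i)"
    using assms(1) by (rule prod.reindex_bij_betw)
  moreover have "(\<Prod>i\<in>V. h i) \<noteq> 0" if "finite V"
    using that assms(2) by simp
  \<comment> \<open>For infinite \<open>V\<close> both sides are \<open>1\<close>, since then
    \<open>card V = 0\<close>.\<close>
  ultimately show ?thesis
    by (cases "finite V") (simp_all add: prod.distrib prod_dividef)
qed

section \<open>The map of a nonnegative tensor\<close>

lemma finite_lists_of_length: "finite {js :: 'n::finite list. length js = k}"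
  using finite_lists_length_eq[of "UNIV :: 'n set" k] by simp

lemma prod_list_map_mono:
  fixes f g :: "'b \<Rightarrow> real"
  assumes "\<And>j. j \<in> set js \<Longrightarrow> 0 \<le> f j \<and> f j \<le> g j"
  shows "(\<Prod>j\<leftarrow>js. f j) \<le> (\<Prod>j\<leftarrow>js. g j)"
  using assms
proof (induction js)
  case (Cons a js)
  have "0 \<le> (\<Prod>j\<leftarrow>js. f j)"
    using Cons.prems by (intro prod_list_nonneg) auto
  with Cons show ?case
    by (auto intro!: mult_mono intro: order_trans)
qed simp

lemma prod_list_map_pos:
  fixes f :: "'b \<Rightarrow> real"
  shows "(\<And>j. j \<in> set js \<Longrightarrow> 0 < f j) \<Longrightarrow> 0 < (\<Prod>j\<leftarrow>js. f j)"
  by (induction js) auto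

lemma prod_list_map_strict_mono:
  fixes f g :: "'b \<Rightarrow> real"
  assumes "\<And>j. j \<in> set js \<Longrightarrow> 0 < f j \<and> f j \<le> g j" and "j \<in> set js" "f j < g j"
  shows "(\<Prod>j\<leftarrow>js. f j) < (\<Prod>j\<leftarrow>js. g j)"
proof -
  from \<open>j \<in> set js\<close> obtain as bs where js: "js = as @ j # bs"
    by (meson split_list)
  have as: "0 < (\<Prod>j\<leftarrow>as. f j)" "(\<Prod>j\<leftarrow>as. f j) \<le> (\<Prod>j\<leftarrow>as. g j)"
    and bs: "0 < (\<Prod>j\<leftarrow>bs. f j)" "(\<Prod>j\<leftarrow>bs. f j) \<le> (\<Prod>j\<leftarrow>bs. g j)"
    using assms(1) js by (auto intro!: prod_list_map_mono prod_list_map_pos simp: less_imp_le)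
  have "f j * (\<Prod>j\<leftarrow>bs. f j) < g j * (\<Prod>j\<leftarrow>bs. g j)"
    using assms bs by (intro mult_less_le_imp_less) (auto simp: less_imp_le)
  then have "(\<Prod>j\<leftarrow>as. f j) * (f j * (\<Prod>j\<leftarrow>bs. f j)) < (\<Prod>j\<leftarrow>as. f j) * (g j * (\<Prod>j\<leftarrow>bs. g j))"
    using as(1) by (rule mult_strict_left_mono)
  also have "\<dots> \<le> (\<Prod>j\<leftarrow>as. g j) * (g j * (\<Prod>j\<leftarrow>bs. g j))"
    using as(2) bs assms(1)[OF \<open>j \<in> set js\<close>] by (intro mult_right_mono) auto
  finally show ?thesis
    by (simp add: js)
qed

lemma tensor_arcs_iff:
  "(i, j) \<in> arcs (tensor_digraph m A) \<longleftrightarrow> (\<exists>js. length js = m - 1 \<and> A (i # js) \<noteq> 0 \<and> j \<in> set js)"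
  by (simp add: tensor_digraph_def)

lemma tensor_apply_nth:
  "tensor_apply m A x $ i = (\<Sum>js | length js = m - 1. A (i # js) * (\<Prod>j\<leftarrow>js. x $ j))"
  by (simp add: tensor_apply_def)

lemma nonneg_tensor_Cons:
  "nonneg_tensor m A \<Longrightarrow> 0 < m \<Longrightarrow> length js = m - 1 \<Longrightarrow> 0 \<le> A (i # js)"
  by (simp add: nonneg_tensor_def)

lemma tensor_apply_scale:
  fixes A :: "('a::comm_semiring_1, 'n::finite) tensor"
  shows "tensor_apply m A (c *s x) $ i = c ^ (m - 1) * tensor_apply m A x $ i"
proof -
  have "(\<Prod>j\<leftarrow>js. (c *s x) $ j) = c ^ length js * (\<Prod>j\<leftarrow>js. x $ j)" for js
    by (induction js) (simp_all add: mult_ac)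
  then show ?thesis
    by (simp add: tensor_apply_nth sum_distrib_left mult_ac)
qed

lemma tensor_apply_nonneg:
  assumes "nonneg_tensor m A" "0 < m" "\<And>j. 0 \<le> y $ j"
  shows "0 \<le> tensor_apply m A y $ i"
  unfolding tensor_apply_nth
  using assms by (intro sum_nonneg mult_nonneg_nonneg prod_list_nonneg) (auto simp: nonneg_tensor_Cons)

text \<open>Terms with nonzero coefficient in row \<open>i\<close> involve only out-neighbours of
  \<open>i\<close>, so a comparison there suffices. This locality is what makes a selection of
  out-neighbours effective.\<close>

lemma tensor_apply_mono:
  fixes A :: "(real, 'n::finite) tensor"
  assumes "nonneg_tensor m A" "0 < m"
    and "\<And>j. (i, j) \<in> arcs (tensor_digraph m A) \<Longrightarrow> 0 \<le> x $ j \<and> x $ j \<le> y $ j"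
  shows "tensor_apply m A x $ i \<le> tensor_apply m A y $ i"
  unfolding tensor_apply_nth
proof (rule sum_mono)
  fix js :: "'n list" assume "js \<in> {js. length js = m - 1}"
  then have js: "length js = m - 1"
    by simp
  show "A (i # js) * (\<Prod>j\<leftarrow>js. x $ j) \<le> A (i # js) * (\<Prod>j\<leftarrow>js. y $ j)"
  proof (cases "A (i # js) = 0")
    case False
    then have "(\<Prod>j\<leftarrow>js. x $ j) \<le> (\<Prod>j\<leftarrow>js. y $ j)"
      using js assms(3) by (intro prod_list_map_mono) (auto simp: tensor_arcs_iff)
    then show ?thesis
      using nonneg_tensor_Cons[OF assms(1,2) js] by (rule mult_left_mono)
  qed simp
qed

text \<open>The arc supplies a monomial with positive coefficient that contains the
  \<open>j\<close>-th coordinate; positivity of \<open>x\<close> keeps the other factors from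
  annihilating the strict gain.\<close>

lemma tensor_apply_strict_mono:
  assumes A: "nonneg_tensor m A" "0 < m" and le: "\<And>j. 0 < x $ j \<and> x $ j \<le> y $ j"
    and arc: "(i, j) \<in> arcs (tensor_digraph m A)" and less: "x $ j < y $ j"
  shows "tensor_apply m A x $ i < tensor_apply m A y $ i"
  unfolding tensor_apply_nth
proof (rule sum_strict_mono_ex1[OF finite_lists_of_length])
  show "\<forall>js\<in>{js. length js = m - 1}.
      A (i # js) * (\<Prod>j\<leftarrow>js. x $ j) \<le> A (i # js) * (\<Prod>j\<leftarrow>js. y $ j)"
    using nonneg_tensor_Cons[OF A] le
    by (auto intro!: mult_left_mono prod_list_map_mono simp: less_imp_le)
  obtain js where js: "length js = m - 1" "A (i # js) \<noteq> 0" "j \<in> set js"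
    using arc by (auto simp: tensor_arcs_iff)
  then have "0 < A (i # js)"
    using nonneg_tensor_Cons[OF A, of js i] by simp
  then have "A (i # js) * (\<Prod>j\<leftarrow>js. x $ j) < A (i # js) * (\<Prod>j\<leftarrow>js. y $ j)"
    using js le less by (intro mult_strict_left_mono prod_list_map_strict_mono) auto
  with js show "\<exists>js\<in>{js. length js = m - 1}.
      A (i # js) * (\<Prod>j\<leftarrow>js. x $ j) < A (i # js) * (\<Prod>j\<leftarrow>js. y $ j)"
    by blast
qed

lemma continuous_on_tensor_apply [continuous_intros]:
  fixes f :: "'b::topological_space \<Rightarrow> real ^ 'n::finite"
  assumes "continuous_on S f"
  shows "continuous_on S (\<lambda>z. tensor_apply m A (f z) $ i)"
proof -
  have "continuous_on S (\<lambda>z. \<Prod>j\<leftarrow>js. f z $ j)" for js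
    using assms by (induction js) (auto intro!: continuous_intros)
  then show ?thesis
    unfolding tensor_apply_nth by (intro continuous_intros)
qed

lemma cmod_tensor_apply_le:
  assumes "nonneg_tensor m A" "0 < m"
  shows "cmod (tensor_apply m (\<lambda>is. complex_of_real (A is)) z $ i)
         \<le> tensor_apply m A (\<chi> j. cmod (z $ j)) $ i"
proof -
  have "cmod (\<Prod>j\<leftarrow>js. z $ j) = (\<Prod>j\<leftarrow>js. cmod (z $ j))" for js
    by (induction js) (simp_all add: norm_mult)
  moreover have eta: "map (($) (\<chi> j. cmod (z $ j))) js = map (\<lambda>j. cmod (z $ j)) js" for js
    by simp
  ultimately show ?thesis
    unfolding tensor_apply_nth
    using nonneg_tensor_Cons[OF assms] by (intro sum_norm_le) (simp add: norm_mult eta)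
qed

lemma tensor_apply_of_real:
  "tensor_apply m (\<lambda>is. complex_of_real (A is)) (\<chi> j. complex_of_real (y $ j)) $ i
   = complex_of_real (tensor_apply m A y $ i)"
proof -
  have "(\<Prod>j\<leftarrow>js. complex_of_real (y $ j)) = complex_of_real (\<Prod>j\<leftarrow>js. y $ j)" for js
    by (induction js) simp_all
  then show ?thesis
    by (simp add: tensor_apply_nth)
qed

section \<open>Consequences of strong connectivity\<close>

lemma weakly_irreducible_rtrancl:
  assumes "weakly_irreducible m A"
  shows "(i, j) \<in> (arcs (tensor_digraph m A))\<^sup>*"
proof -
  have "i \<rightarrow>\<^sup>*\<^bsub>tensor_digraph m A\<^esub> j"
    using assms by (simp add: weakly_irreducible_def strongly_connected_def tensor_digraph_def)
  moreover have "arcs_ends (tensor_digraph m A) = arcs (tensor_digraph m A)"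
    by (simp add: arcs_ends_conv tensor_digraph_def)
  ultimately show ?thesis
    unfolding reachable_def by (metis rtrancl_on_rtranclI)
qed

text \<open>A walk from a point of \<open>I\<close> to a point outside must cross the boundary at
  some arc.\<close>

lemma weakly_irreducible_arc_leaving:
  assumes "weakly_irreducible m A" "I \<noteq> {}" "I \<noteq> UNIV"
  obtains i j where "i \<in> I" "j \<notin> I" "(i, j) \<in> arcs (tensor_digraph m A)"
proof -
  obtain a b where "a \<in> I" "b \<notin> I"
    using assms by blast
  from weakly_irreducible_rtrancl[OF assms(1), of a b]
  have "\<exists>i j. i \<in> I \<and> j \<notin> I \<and> (i, j) \<in> arcs (tensor_digraph m A)"
    using \<open>a \<in> I\<close> \<open>b \<notin> I\<close> by (induction rule: rtrancl_induct) blast+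
  then show thesis
    using that by blast
qed

text \<open>A walk from \<open>i\<close> to \<open>a\<close> either has a first arc or is trivial,
  and then the given arc leaves \<open>i\<close>. That arc excludes the single vertex without a
  loop.\<close>

lemma weakly_irreducible_out_neighbour:
  assumes "weakly_irreducible m A" "(a, b) \<in> arcs (tensor_digraph m A)"
  shows "\<exists>j. (i, j) \<in> arcs (tensor_digraph m A)"
  using weakly_irreducible_rtrancl[OF assms(1), of i a] assms(2)
  by (cases rule: converse_rtranclE) blast+

section \<open>The positive eigenvector\<close>

text \<open>For positive \<open>y\<close>, the least admissible \<open>l\<close> is the largest
  Collatz-Wielandt ratio of \<open>y\<close>. Minimizing \<open>l\<close> over all pairs is thus the
  min-max problem, with constraints free of division.\<close>

definition supersolution :: "nat \<Rightarrow> (real, 'n::finite) tensor \<Rightarrow> real \<Rightarrow> real ^ 'n \<Rightarrow> bool" where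
  "supersolution m A l y \<longleftrightarrow>
     (\<forall>i. 0 < y $ i) \<and> (\<forall>i. tensor_apply m A y $ i \<le> l * y $ i ^ (m - 1))"

lemma finite_arg_max:
  fixes f :: "'a::finite \<Rightarrow> real"
  assumes "S \<noteq> {}"
  obtains j where "j \<in> S" "\<And>k. k \<in> S \<Longrightarrow> f k \<le> f j"
proof -
  have "Max (f ` S) \<in> f ` S"
    using assms by (intro Max_in) auto
  then obtain j where "j \<in> S" "f j = Max (f ` S)"
    by auto
  then show thesis
    using that[of j] by simp
qed

lemma supersolution_mono:
  assumes "supersolution m A l y" "l \<le> l'"
  shows "supersolution m A l' y"
proof -
  have "l * y $ i ^ (m - 1) \<le> l' * y $ i ^ (m - 1)" for i
    using assms by (intro mult_right_mono) (auto simp: supersolution_def less_imp_le)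
  then show ?thesis
    using assms(1) unfolding supersolution_def by (meson order_trans)
qed

lemma supersolution_scale:
  assumes "supersolution m A l y" "0 < c"
  shows "supersolution m A l (c *s y)"
  using assms
  by (auto simp: supersolution_def tensor_apply_scale power_mult_distrib mult.left_commute
      simp del: vector_scalar_mult_def)

lemma supersolution_nonneg:
  assumes "nonneg_tensor m A" "0 < m" "supersolution m A l y"
  shows "0 \<le> l"
proof -
  have "0 \<le> tensor_apply m A y $ undefined"
    using assms by (intro tensor_apply_nonneg) (auto simp: supersolution_def less_imp_le)
  also have "\<dots> \<le> l * y $ undefined ^ (m - 1)"
    using assms by (simp add: supersolution_def)
  finally have "0 \<le> l * y $ undefined ^ (m - 1)" .
  moreover have "0 < y $ undefined ^ (m - 1)"
    using assms(3) by (simp add: supersolution_def)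
  ultimately show ?thesis
    by (metis zero_le_mult_iff not_le)
qed

text \<open>With all coordinates at least \<open>1\<close>, the remaining factors of the monomial
  can only enlarge \<open>y $ j\<close>, and the monomial is one of the nonnegative summands of row
  \<open>i\<close>.\<close>

lemma supersolution_arc_bound:
  fixes A :: "(real, 'n::finite) tensor"
  assumes A: "nonneg_tensor m A" "0 < m" and y: "\<And>i. 1 \<le> y $ i" "supersolution m A l y"
    and js: "length js = m - 1" "j \<in> set js"
  shows "A (i # js) * y $ j \<le> l * y $ i ^ (m - 1)"
proof -
  have "y $ j \<le> (\<Prod>j\<leftarrow>js. y $ j)"
  proof -
    obtain as bs where split: "js = as @ j # bs"
      using js by (meson split_list)
    have ge_1: "1 \<le> (\<Prod>j\<leftarrow>js. y $ j)" for js
      using prod_list_map_mono[of js "\<lambda>_. 1" "\<lambda>j. y $ j"] y(1)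
      by (simp add: map_replicate_const)
    have "1 * (y $ j * 1) \<le> (\<Prod>j\<leftarrow>as. y $ j) * (y $ j * (\<Prod>j\<leftarrow>bs. y $ j))"
      using ge_1[of as] ge_1[of bs] y(1)[of j] by (intro mult_mono) auto
    then show ?thesis
      by (simp add: split)
  qed
  then have "A (i # js) * y $ j \<le> A (i # js) * (\<Prod>j\<leftarrow>js. y $ j)"
    using nonneg_tensor_Cons[OF A js(1)] by (rule mult_left_mono)
  also have "\<dots> \<le> tensor_apply m A y $ i"
    unfolding tensor_apply_nth
  proof (rule member_le_sum[OF _ _ finite_lists_of_length])
    fix ks :: "'n list" assume "ks \<in> {ks. length ks = m - 1} - {js}"
    then show "0 \<le> A (i # ks) * (\<Prod>j\<leftarrow>ks. y $ j)"
      using y(2) nonneg_tensor_Cons[OF A]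
      by (intro mult_nonneg_nonneg prod_list_nonneg) (auto simp: supersolution_def less_imp_le)
  qed (use js in simp)
  also have "\<dots> \<le> l * y $ i ^ (m - 1)"
    using y(2) by (simp add: supersolution_def)
  finally show ?thesis .
qed

text \<open>
  After scaling to \<open>min y = 1\<close>, walking along arcs from a minimal coordinate bounds every coordinate.
  This confines the minimization below to a compact box.
\<close>

lemma supersolution_bound:
  assumes A: "nonneg_tensor m A" "weakly_irreducible m A" "0 < m"
  obtains C where "\<And>y j. (\<And>i. 1 \<le> y $ i) \<Longrightarrow> y $ i\<^sub>0 = 1 \<Longrightarrow> supersolution m A l y \<Longrightarrow> y $ j \<le> C"
proof -
  define Q where "Q y \<longleftrightarrow> (\<forall>i. 1 \<le> y $ i) \<and> y $ i\<^sub>0 = 1 \<and> supersolution m A l y" for y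
  have "\<exists>D. \<forall>y. Q y \<longrightarrow> y $ j \<le> D" for j
    using weakly_irreducible_rtrancl[OF A(2), of i\<^sub>0 j]
  proof (induction rule: rtrancl_induct)
    case base
    then show ?case
      by (auto simp: Q_def)
  next
    case (step j k)
    then obtain D where D: "\<And>y. Q y \<Longrightarrow> y $ j \<le> D"
      by blast
    obtain js where js: "length js = m - 1" "A (j # js) \<noteq> 0" "k \<in> set js"
      using step.hyps by (auto simp: tensor_arcs_iff)
    then have pos: "0 < A (j # js)"
      using nonneg_tensor_Cons[OF A(1,3), of js j] by simp
    have "y $ k \<le> l * D ^ (m - 1) / A (j # js)" if "Q y" for y
    proof -
      have y: "\<And>i. 1 \<le> y $ i" "supersolution m A l y"
        using that by (auto simp: Q_def)
      have "A (j # js) * y $ k \<le> l * y $ j ^ (m - 1)"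
        by (rule supersolution_arc_bound[OF A(1,3) y js(1,3)])
      also have "\<dots> \<le> l * D ^ (m - 1)"
        using D[OF that] y supersolution_nonneg[OF A(1,3) y(2)]
        by (intro mult_left_mono power_mono) (auto simp: supersolution_def less_imp_le)
      finally show ?thesis
        using pos by (simp add: field_simps)
    qed
    then show ?case
      by blast
  qed
  then obtain D where D: "\<And>y j. Q y \<Longrightarrow> y $ j \<le> D j"
    by metis
  have "y $ j \<le> Max (range D)" if "Q y" for y j
    using D[OF that] by (rule order_trans) simp
  then show thesis
    using that unfolding Q_def by blast
qed

lemma supersolution_normalize:
  assumes "supersolution m A l y"
  obtains y' i\<^sub>0 where "supersolution m A l y'" "\<forall>i. 1 \<le> y' $ i" "y' $ i\<^sub>0 = 1"
proof -
  obtain i\<^sub>0 where i\<^sub>0: "\<And>i. y $ i\<^sub>0 \<le> y $ i"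
    using finite_arg_max[of UNIV "\<lambda>i. - (y $ i)"] by auto
  have pos: "0 < y $ i" for i
    using assms by (simp add: supersolution_def)
  show thesis
  proof (rule that[of "(1 / y $ i\<^sub>0) *s y" i\<^sub>0])
    show "supersolution m A l ((1 / y $ i\<^sub>0) *s y)"
      using assms pos by (intro supersolution_scale) auto
  qed (use pos i\<^sub>0 in \<open>auto simp: less_imp_neq[symmetric]\<close>)
qed

text \<open>Normalized supersolutions with \<open>l \<le> L\<close> lie in a compact set of pairs,
  on which the second component attains its minimum. Any \<open>l'\<close> above \<open>L\<close> is
  no competitor.\<close>

lemma minimal_supersolution:
  assumes A: "nonneg_tensor m A" "weakly_irreducible m A" "0 < m"
  obtains l y where "supersolution m A l y" "\<And>l' y'. supersolution m A l' y' \<Longrightarrow> l \<le> l'"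
proof -
  \<comment> \<open>The all-ones vector is a supersolution for this value, since each row sum is at
    most the total.\<close>
  define L where "L = (\<Sum>i\<in>UNIV. tensor_apply m A 1 $ i)"
  have super_1: "supersolution m A L 1"
    using tensor_apply_nonneg[OF A(1,3), of 1]
    by (auto simp: supersolution_def L_def intro!: member_le_sum)
  have "\<exists>C. \<forall>y j. (\<forall>i. 1 \<le> y $ i) \<longrightarrow> y $ i\<^sub>0 = 1 \<longrightarrow> supersolution m A L y \<longrightarrow> y $ j \<le> C" for i\<^sub>0
    by (rule supersolution_bound[OF A, of i\<^sub>0 L]) blast
  then obtain C where C: "\<And>i\<^sub>0 y j. (\<And>i. 1 \<le> y $ i) \<Longrightarrow> y $ i\<^sub>0 = 1 \<Longrightarrow> supersolution m A L y
      \<Longrightarrow> y $ j \<le> C i\<^sub>0"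
    by metis
  \<comment> \<open>The bound depends on the coordinate that equals \<open>1\<close>; the maximum
    over all positions gives a single box.\<close>
  define B where "B = Max (range C)"
  \<comment> \<open>The lower corner \<open>1\<close> keeps all coordinates away from
    \<open>0\<close>, so the minimizer is again positive.\<close>
  define S where "S = {z \<in> cbox 1 (\<chi> _. B) \<times> {0..L}.
      \<forall>i. tensor_apply m A (fst z) $ i \<le> snd z * fst z $ i ^ (m - 1)}"
  have in_S: "(y, l) \<in> S" if "\<And>i. 1 \<le> y $ i" "y $ i\<^sub>0 = 1" "supersolution m A l y" "l \<le> L" for y l i\<^sub>0
  proof -
    have "y $ j \<le> B" for j
      unfolding B_def
      using C[OF that(1,2) supersolution_mono[OF that(3,4)]] by (rule order_trans) simp
    then show ?thesis
      using that supersolution_nonneg[OF A(1,3) that(3)]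
      by (simp add: S_def mem_box_cart supersolution_def)
  qed
  have "S = (cbox 1 (\<chi> _. B) \<times> {0..L}) \<inter>
      {z. \<forall>i. tensor_apply m A (fst z) $ i \<le> snd z * fst z $ i ^ (m - 1)}"
    by (auto simp: S_def)
  moreover have "closed {z. \<forall>i. tensor_apply m A (fst z) $ i \<le> snd z * fst z $ i ^ (m - 1)}"
    by (intro closed_Collect_all closed_Collect_le continuous_intros)
  ultimately have "compact S"
    by (simp add: compact_Int_closed compact_Times)
  moreover have "S \<noteq> {}"
    using in_S[of 1 _ L] super_1 by auto
  ultimately have "\<exists>z\<in>S. \<forall>w\<in>S. snd z \<le> snd w"
    by (intro continuous_attains_inf continuous_intros)
  then obtain z where z: "z \<in> S" "\<And>w. w \<in> S \<Longrightarrow> snd z \<le> snd w"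
    by blast
  show thesis
  proof (rule that)
    show "supersolution m A (snd z) (fst z)"
      unfolding supersolution_def
    proof (intro conjI allI)
      fix i
      have "1 \<le> fst z $ i"
        using z(1) by (auto simp: S_def mem_box_cart)
      then show "0 < fst z $ i"
        by simp
      show "tensor_apply m A (fst z) $ i \<le> snd z * fst z $ i ^ (m - 1)"
        using z(1) by (simp add: S_def)
    qed
    fix l' y' assume y': "supersolution m A l' y'"
    obtain y i\<^sub>0 where "supersolution m A l' y" "\<forall>i. 1 \<le> y $ i" "y $ i\<^sub>0 = 1"
      by (rule supersolution_normalize[OF y'])
    then have "(y, l') \<in> S" if "l' \<le> L"
      using that by (intro in_S) auto
    moreover have "snd z \<le> L"
      using z(1) by (auto simp: S_def)
    ultimately show "snd z \<le> l'"
      using z(2) by (cases "l' \<le> L") auto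
  qed
qed

text \<open>
  If equality failed in some coordinate, an arc \<open>i \<rightarrow> j\<close> would lead from an equality coordinate to a
  strict one. Decreasing \<open>y\<^sub>j\<close> slightly keeps the supersolution and makes \<open>i\<close> strict.
\<close>

lemma positive_eigenvector:
  assumes A: "nonneg_tensor m A" "weakly_irreducible m A" "0 < m"
  obtains l y where "0 \<le> l" "\<And>i. 0 < y $ i" "\<And>i. tensor_apply m A y $ i = l * y $ i ^ (m - 1)"
proof -
  obtain l y\<^sub>0 where y\<^sub>0: "supersolution m A l y\<^sub>0"
    and l: "\<And>l' y'. supersolution m A l' y' \<Longrightarrow> l \<le> l'"
    by (rule minimal_supersolution[OF A]) blast
  define I where "I y = {i. tensor_apply m A y $ i = l * y $ i ^ (m - 1)}" for y
  \<comment> \<open>Among the supersolutions for the minimal \<open>l\<close>, take one with the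
    fewest equality coordinates; the perturbation below would reduce their number.\<close>
  obtain y where y: "supersolution m A l y"
    and I_min: "\<And>y'. supersolution m A l y' \<Longrightarrow> card (I y) \<le> card (I y')"
    using ex_has_least_nat[of "supersolution m A l" y\<^sub>0 "\<lambda>y. card (I y)"] y\<^sub>0 by blast
  have pos: "0 < y $ i" and le: "tensor_apply m A y $ i \<le> l * y $ i ^ (m - 1)" for i
    using y by (auto simp: supersolution_def)
  \<comment> \<open>If every inequality were strict, the largest ratio would be an admissible value
    below the minimal \<open>l\<close>.\<close>
  have "I y \<noteq> {}"
  proof
    assume "I y = {}"
    then have less: "tensor_apply m A y $ i / y $ i ^ (m - 1) < l" for i
    proof -
      have "tensor_apply m A y $ i < l * y $ i ^ (m - 1)"
        using le[of i] \<open>I y = {}\<close> by (auto simp: I_def order_less_le)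
      then show ?thesis
        using pos[of i] by (simp add: pos_divide_less_eq)
    qed
    define l' where "l' = (MAX i. tensor_apply m A y $ i / y $ i ^ (m - 1))"
    have "tensor_apply m A y $ i / y $ i ^ (m - 1) \<le> l'" for i
      unfolding l'_def by (rule Max_ge) auto
    then have "supersolution m A l' y"
      using pos by (simp add: supersolution_def divide_le_eq)
    moreover have "l' < l"
      unfolding l'_def by (subst Max_less_iff) (auto simp del: One_nat_def intro: less)
    ultimately show False
      using l by force
  qed
  have "I y = UNIV"
  proof (rule ccontr)
    assume "I y \<noteq> UNIV"
    with \<open>I y \<noteq> {}\<close> obtain i j
      where i: "i \<in> I y" and j: "j \<notin> I y" and arc: "(i, j) \<in> arcs (tensor_digraph m A)"
      using weakly_irreducible_arc_leaving[OF A(2)] by blast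
    have strict: "tensor_apply m A y $ j < l * y $ j ^ (m - 1)"
      using j le[of j] by (simp add: I_def)
    \<comment> \<open>Continuity from the left leaves room to lower coordinate \<open>j\<close>
      while it stays positive and its inequality strict.\<close>
    have "((\<lambda>s. l * s ^ (m - 1)) \<longlongrightarrow> l * y $ j ^ (m - 1)) (at_left (y $ j))"
      by (intro tendsto_intros)
    then have "eventually (\<lambda>s. tensor_apply m A y $ j < l * s ^ (m - 1)) (at_left (y $ j))"
      using strict by (rule order_tendstoD)
    moreover have "eventually (\<lambda>s. s \<in> {0<..<y $ j}) (at_left (y $ j))"
      using pos[of j] by (rule eventually_at_left_real)
    ultimately have "eventually (\<lambda>s. tensor_apply m A y $ j < l * s ^ (m - 1) \<and> s \<in> {0<..<y $ j})
        (at_left (y $ j))"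
      by (rule eventually_conj)
    then have "\<exists>s. tensor_apply m A y $ j < l * s ^ (m - 1) \<and> s \<in> {0<..<y $ j}"
      by (rule eventually_happens'[OF trivial_limit_at_left_real])
    then obtain s where s: "0 < s" "s < y $ j" "tensor_apply m A y $ j < l * s ^ (m - 1)"
      by auto
    define y' where "y' = (\<chi> k. if k = j then s else y $ k)"
    have y'_le: "0 < y' $ k \<and> y' $ k \<le> y $ k" for k
      using s pos by (simp add: y'_def)
    have apply_le: "tensor_apply m A y' $ k \<le> tensor_apply m A y $ k" for k
      using y'_le by (intro tensor_apply_mono[OF A(1,3)]) (auto simp: less_imp_le)
    have "tensor_apply m A y' $ i < tensor_apply m A y $ i"
      using s by (intro tensor_apply_strict_mono[OF A(1,3) y'_le arc]) (simp add: y'_def)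
    moreover have "i \<noteq> j"
      using i j by blast
    ultimately have "i \<notin> I y'"
      using le[of i] by (auto simp: I_def y'_def)
    \<comment> \<open>No new equality appears: at \<open>j\<close> the choice of \<open>s\<close>
      keeps strictness, and elsewhere the right side is unchanged while the left side does not
      grow.\<close>
    moreover have "I y' \<subseteq> I y"
    proof
      fix k assume "k \<in> I y'"
      then show "k \<in> I y"
        using apply_le[of k] le[of k] s by (cases "k = j") (auto simp: I_def y'_def)
    qed
    ultimately have "card (I y') < card (I y)"
      using i by (intro psubset_card_mono) auto
    moreover have "supersolution m A l y'"
      unfolding supersolution_def
    proof (intro conjI allI)
      fix k
      show "0 < y' $ k"
        using y'_le by blast
      show "tensor_apply m A y' $ k \<le> l * y' $ k ^ (m - 1)"
        using apply_le[of k] le[of k] s by (cases "k = j") (auto simp: y'_def)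
    qed
    ultimately show False
      using I_min by fastforce
  qed
  then show thesis
    using that[of l y] pos supersolution_nonneg[OF A(1,3) y] by (auto simp: I_def)
qed

section \<open>Comparison with the eigenvector and the spectral radius\<close>

lemma tensor_apply_le_of_ratio:
  assumes A: "nonneg_tensor m A" "0 < m" and y: "\<And>i. tensor_apply m A y $ i = l * y $ i ^ (m - 1)"
    and x: "\<And>j. (i, j) \<in> arcs (tensor_digraph m A) \<Longrightarrow> 0 \<le> x $ j \<and> x $ j \<le> t * y $ j"
  shows "tensor_apply m A x $ i \<le> l * (t * y $ i) ^ (m - 1)"
proof -
  \<comment> \<open>On \<open>t *s y\<close> homogeneity and the eigenvector equation give the exact
    value.\<close>
  have "tensor_apply m A x $ i \<le> tensor_apply m A (t *s y) $ i"
    using x by (intro tensor_apply_mono[OF A]) auto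
  then show ?thesis
    by (simp add: tensor_apply_scale y power_mult_distrib mult_ac)
qed

lemma tensor_apply_ge_of_ratio:
  assumes A: "nonneg_tensor m A" "0 < m" and y: "\<And>i. tensor_apply m A y $ i = l * y $ i ^ (m - 1)"
    and x: "\<And>j. (i, j) \<in> arcs (tensor_digraph m A) \<Longrightarrow> 0 \<le> t * y $ j \<and> t * y $ j \<le> x $ j"
  shows "l * (t * y $ i) ^ (m - 1) \<le> tensor_apply m A x $ i"
proof -
  have "tensor_apply m A (t *s y) $ i \<le> tensor_apply m A x $ i"
    using x by (intro tensor_apply_mono[OF A]) auto
  then show ?thesis
    by (simp add: tensor_apply_scale y power_mult_distrib mult_ac)
qed

text \<open>The vector \<open>y\<close> itself realizes \<open>l\<close>. For any eigenvector
  \<open>z\<close>, choose \<open>i\<close> maximizing \<open>cmod (z $ i) / y $ i\<close>: with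
  this ratio as \<open>t\<close>, the moduli are dominated by \<open>t *s y\<close> with equality at
  \<open>i\<close>, which forces the modulus of the eigenvalue below \<open>l\<close>. So the
  greatest modulus exists.\<close>

lemma tensor_spectral_radius_eq:
  assumes A: "nonneg_tensor m A" "0 < m"
    and y: "0 \<le> l" "\<And>i. 0 < y $ i" "\<And>i. tensor_apply m A y $ i = l * y $ i ^ (m - 1)"
  shows "tensor_spectral_radius m (\<lambda>is. complex_of_real (A is)) = l"
  unfolding tensor_spectral_radius_def
proof (rule Greatest_equality)
  define z where "z = (\<chi> j. complex_of_real (y $ j))"
  have "z $ undefined \<noteq> 0"
    using y(2)[of undefined] by (simp add: z_def)
  then have "z \<noteq> 0"
    by auto
  moreover have "tensor_apply m (\<lambda>is. complex_of_real (A is)) z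
      = (\<chi> i. complex_of_real l * z $ i ^ (m - 1))"
    by (simp add: vec_eq_iff z_def tensor_apply_of_real y)
  ultimately have "tensor_eigenvalue m (\<lambda>is. complex_of_real (A is)) (complex_of_real l)"
    unfolding tensor_eigenvalue_def by blast
  then show "\<exists>k. tensor_eigenvalue m (\<lambda>is. complex_of_real (A is)) k \<and> l = cmod k"
    using y(1) by (intro exI[of _ "complex_of_real l"]) simp
next
  fix r assume "\<exists>k. tensor_eigenvalue m (\<lambda>is. complex_of_real (A is)) k \<and> r = cmod k"
  then obtain k z where r: "r = cmod k" and "z \<noteq> 0"
    and z: "\<And>i. tensor_apply m (\<lambda>is. complex_of_real (A is)) z $ i = k * z $ i ^ (m - 1)"
    unfolding tensor_eigenvalue_def by force
  obtain i where i: "\<And>j. cmod (z $ j) / y $ j \<le> cmod (z $ i) / y $ i"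
    using finite_arg_max[of UNIV "\<lambda>j. cmod (z $ j) / y $ j"] by auto
  obtain j where "z $ j \<noteq> 0"
    using \<open>z \<noteq> 0\<close> by (auto simp: vec_eq_iff)
  then have "0 < cmod (z $ j) / y $ j"
    using y(2) by simp
  with i have "0 < cmod (z $ i) / y $ i"
    by (rule order.strict_trans2[rotated])
  then have pos: "0 < cmod (z $ i)"
    using y(2)[of i] by (simp add: zero_less_divide_iff)
  have "r * cmod (z $ i) ^ (m - 1) = cmod (tensor_apply m (\<lambda>is. complex_of_real (A is)) z $ i)"
    by (simp add: z r norm_mult norm_power)
  also have "\<dots> \<le> tensor_apply m A (\<chi> j. cmod (z $ j)) $ i"
    by (rule cmod_tensor_apply_le[OF A])
  also have "\<dots> \<le> l * (cmod (z $ i) / y $ i * y $ i) ^ (m - 1)"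
    using i y(2) by (intro tensor_apply_le_of_ratio[OF A y(3)]) (simp add: pos_divide_le_eq)
  also have "\<dots> = l * cmod (z $ i) ^ (m - 1)"
    using y(2)[of i] by simp
  finally show "r \<le> l"
    using pos by simp
qed

section \<open>The circuit bounds\<close>

theorem theorem3p6:
  fixes A :: "(real, 'n::finite) tensor" and m :: nat and x :: "real ^ 'n"
  assumes "nonneg_tensor m A"
    and "weakly_irreducible m A"
    and "\<And>i. 0 < x $ i"
    and "circuits (tensor_digraph m A) \<noteq> {}"
  shows "(MIN p\<in>circuits (tensor_digraph m A).
            circuit_mean (tensor_digraph m A) (\<lambda>i. tensor_apply m A x $ i / x $ i ^ (m - 1)) p)
         \<le> tensor_spectral_radius m (\<lambda>is. complex_of_real (A is))
       \<and> tensor_spectral_radius m (\<lambda>is. complex_of_real (A is))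
         \<le> (MAX p\<in>circuits (tensor_digraph m A).
            circuit_mean (tensor_digraph m A) (\<lambda>i. tensor_apply m A x $ i / x $ i ^ (m - 1)) p)"
proof -
  let ?G = "tensor_digraph m A"
  define f where "f = (\<lambda>i. tensor_apply m A x $ i / x $ i ^ (m - 1))"
  obtain a b p where "(a, b) # p \<in> circuits ?G"
    using assms(4) by (metis all_not_in_conv circuits_def list.exhaust mem_Collect_eq
        pre_digraph.cycle_def surj_pair)
  then have arc: "(a, b) \<in> arcs ?G"
    by (auto simp: circuits_def pre_digraph.cycle_def pre_digraph.awalk_def)
  \<comment> \<open>An arc requires a nonempty index list of length \<open>m - 1\<close>, which is
    impossible for \<open>m = 0\<close>.\<close>
  then have m: "0 < m"
    by (cases m) (auto simp: tensor_arcs_iff)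
  obtain l y where l: "0 \<le> l" and y: "\<And>i. 0 < y $ i"
    and eigen: "\<And>i. tensor_apply m A y $ i = l * y $ i ^ (m - 1)"
    using positive_eigenvector[OF assms(1,2) m] by blast
  have radius: "tensor_spectral_radius m (\<lambda>is. complex_of_real (A is)) = l"
    by (rule tensor_spectral_radius_eq[OF assms(1) m l y eigen])
  define u where "u i = x $ i / y $ i" for i
  have u: "0 < u i" "u i * y $ i = x $ i" for i
    using y[of i] assms(3)[of i] by (simp_all add: u_def)
  have f_nonneg: "0 \<le> f i" for i
    using assms(3) tensor_apply_nonneg[OF assms(1) m, of x] by (simp add: f_def less_imp_le)
  \<comment> \<open>With \<open>t = u (s i)\<close> this is \<open>l\<close> times a quotient of
    values of \<open>u i ^ (m - 1)\<close> at \<open>s i\<close> and at \<open>i\<close>, the form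
    that cancels around a circuit.\<close>
  have ratio: "l * (t * y $ i) ^ (m - 1) / x $ i ^ (m - 1) = l * (t ^ (m - 1) / u i ^ (m - 1))" for t i
    using u(2)[of i, symmetric] y[of i] by (simp add: power_mult_distrib)
  have out: "{j. (i, j) \<in> arcs ?G} \<noteq> {}" for i
    using weakly_irreducible_out_neighbour[OF assms(2) arc, of i] by blast
  have G: "verts ?G = UNIV" "tail ?G = fst" "head ?G = snd"
    by (simp_all add: tensor_digraph_def)
  have fin: "finite (circuits ?G)"
    by (intro finite_circuits) simp
  \<comment> \<open>The product telescopes to \<open>l ^ length c\<close>, and
    \<open>0 \<le> l\<close> lets the root recover \<open>l\<close>.\<close>
  have mean_prod: "circuit_mean ?G (\<lambda>i. l * (u (s i) ^ (m - 1) / u i ^ (m - 1))) c = l"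
    if "card (circuit_verts ?G c) = length c" "c \<noteq> []"
      "bij_betw s (circuit_verts ?G c) (circuit_verts ?G c)" for s c
  proof -
    have "u i ^ (m - 1) \<noteq> 0" for i
      using u(1)[of i] by simp
    then have "(\<Prod>i\<in>circuit_verts ?G c. l * (u (s i) ^ (m - 1) / u i ^ (m - 1))) = l ^ length c"
      using prod_cocycle[OF that(3), of "\<lambda>i. u i ^ (m - 1)" l] that(1) by simp
    then show ?thesis
      using that(2) l by (simp add: circuit_mean_def real_root_power_cancel del: One_nat_def)
  qed
  have mean_mono: "circuit_mean ?G g c \<le> circuit_mean ?G h c"
    if "c \<noteq> []" "\<And>i. 0 \<le> g i \<and> g i \<le> h i" for g h c
    using that by (auto simp: circuit_mean_def intro!: real_root_le_mono prod_mono)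
  \<comment> \<open>Selecting the largest \<open>u\<close> bounds every \<open>f i\<close> from
    above, so the traced circuit has mean at most \<open>l\<close>, and the minimum is no
    larger.\<close>
  have "Min (circuit_mean ?G f ` circuits ?G) \<le> l"
  proof -
    have "\<exists>j. (i, j) \<in> arcs ?G \<and> (\<forall>k. (i, k) \<in> arcs ?G \<longrightarrow> u k \<le> u j)" for i
      by (rule finite_arg_max[OF out, of i u]) auto
    then obtain s where s: "\<And>i. (i, s i) \<in> arcs ?G" "\<And>i k. (i, k) \<in> arcs ?G \<Longrightarrow> u k \<le> u (s i)"
      by metis
    obtain c where c: "c \<in> circuits ?G" "card (circuit_verts ?G c) = length c" "c \<noteq> []"
      "bij_betw s (circuit_verts ?G c) (circuit_verts ?G c)"
      using circuit_of_selection[OF G s(1)] by blast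
    have "f i \<le> l * (u (s i) ^ (m - 1) / u i ^ (m - 1))" for i
    proof -
      have "tensor_apply m A x $ i \<le> l * (u (s i) * y $ i) ^ (m - 1)"
      proof (intro tensor_apply_le_of_ratio[OF assms(1) m eigen] conjI)
        fix j assume "(i, j) \<in> arcs ?G"
        then show "x $ j \<le> u (s i) * y $ j"
          using mult_right_mono[OF s(2), of i j "y $ j"] y[of j] u(2)[of j] by simp
      qed (use assms(3) in \<open>simp add: less_imp_le\<close>)
      then show ?thesis
        using assms(3)[of i] unfolding f_def ratio[symmetric] by (simp add: divide_right_mono)
    qed
    then have "circuit_mean ?G f c
        \<le> circuit_mean ?G (\<lambda>i. l * (u (s i) ^ (m - 1) / u i ^ (m - 1))) c"
      using f_nonneg by (intro mean_mono c(3)) blast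
    also have "\<dots> = l"
      by (rule mean_prod[OF c(2-)])
    finally show ?thesis
      using fin c(1) by (auto intro: order_trans[OF Min_le])
  qed
  \<comment> \<open>Selecting the smallest \<open>u\<close> reverses the estimate: the traced
    circuit has mean at least \<open>l\<close>. Minimizing \<open>u\<close> is maximizing
    \<open>- u\<close>.\<close>
  moreover have "l \<le> Max (circuit_mean ?G f ` circuits ?G)"
  proof -
    have "\<exists>j. (i, j) \<in> arcs ?G \<and> (\<forall>k. (i, k) \<in> arcs ?G \<longrightarrow> u j \<le> u k)" for i
      by (rule finite_arg_max[OF out, of i "\<lambda>j. - u j"]) auto
    then obtain s where s: "\<And>i. (i, s i) \<in> arcs ?G" "\<And>i k. (i, k) \<in> arcs ?G \<Longrightarrow> u (s i) \<le> u k"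
      by metis
    obtain c where c: "c \<in> circuits ?G" "card (circuit_verts ?G c) = length c" "c \<noteq> []"
      "bij_betw s (circuit_verts ?G c) (circuit_verts ?G c)"
      using circuit_of_selection[OF G s(1)] by blast
    have "0 \<le> l * (u (s i) ^ (m - 1) / u i ^ (m - 1))
        \<and> l * (u (s i) ^ (m - 1) / u i ^ (m - 1)) \<le> f i" for i
    proof
      show "0 \<le> l * (u (s i) ^ (m - 1) / u i ^ (m - 1))"
        using l u(1) by (simp add: less_imp_le)
      have "l * (u (s i) * y $ i) ^ (m - 1) \<le> tensor_apply m A x $ i"
      proof (intro tensor_apply_ge_of_ratio[OF assms(1) m eigen] conjI)
        fix j assume "(i, j) \<in> arcs ?G"
        then show "u (s i) * y $ j \<le> x $ j"
          using mult_right_mono[OF s(2), of i j "y $ j"] y[of j] u(2)[of j] by simp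
      qed (use u(1) y in \<open>simp add: less_imp_le\<close>)
      then show "l * (u (s i) ^ (m - 1) / u i ^ (m - 1)) \<le> f i"
        using assms(3)[of i] unfolding f_def ratio[symmetric] by (simp add: divide_right_mono)
    qed
    then have "circuit_mean ?G (\<lambda>i. l * (u (s i) ^ (m - 1) / u i ^ (m - 1))) c
        \<le> circuit_mean ?G f c"
      by (rule mean_mono[OF c(3)])
    then have "l \<le> circuit_mean ?G f c"
      by (simp only: mean_prod[OF c(2-)])
    then show ?thesis
      using fin c(1) by (auto intro: order_trans[OF _ Max_ge])
  qed
  ultimately show ?thesis
    unfolding radius f_def by blast
qed

end
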